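(* There exists $\widehat{q}\in(0,1)$ such that for every $q\in(\widehat{q},1)$ and every real $x>-1$ the following hold: for every real $\alpha\ge 1$, $$(1+x)_q^\alpha \;\ge\; 1+[\alpha]_q\,x,$$ and for every real $\alpha$ with $0<\alpha<1$, $$(1+x)_q^\alpha \;\le\; 1+[\alpha]_q\,x .$$
   Context: For $q\in(0,1)$ and real $\alpha$, $[\alpha]_q=\frac{q^\alpha-1}{q-1}$. For real $x$, $(1+x)_q^\infty=\prod_{j=0}^{\infty}(1+q^j x)$ (a convergent infinite product), and $(1+x)_q^\alpha=\dfrac{(1+x)_q^\infty}{(1+q^\alpha x)_q^\infty}$, where $(1+q^\alpha x)_q^\infty=\prod_{j=0}^\infty(1+q^{j+\alpha}x)$. *)

theory Defs
  imports "HOL-Analysis.Analysis"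
begin

definition q_number :: "real \<Rightarrow> real \<Rightarrow> real" where
  "q_number q \<alpha> = (q powr \<alpha> - 1) / (q - 1)"

definition q_prod_inf :: "real \<Rightarrow> real \<Rightarrow> real" where
  "q_prod_inf q x = (\<Prod>j. 1 + q ^ j * x)"

text \<open>
  The real-exponent q-power \<open>(1 + x)\<^sub>q\<^sup>\<alpha>\<close>; the first argument after the base is \<open>x\<close>, not \<open>1 + x\<close>.
\<close>
definition q_binom_power :: "real \<Rightarrow> real \<Rightarrow> real \<Rightarrow> real" where
  "q_binom_power q x \<alpha> = q_prod_inf q x / q_prod_inf q (q powr \<alpha> * x)"

text \<open>
  For \<open>0 < q < 1\<close> the product converges for every real \<open>x\<close>, also when a factor vanishes.
\<close>
lemma q_prod_inf_has_prod:
  assumes "0 < q" "q < 1"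
  shows "(\<lambda>j. 1 + q ^ j * x) has_prod q_prod_inf q x"
proof -
  have "summable (\<lambda>j. norm (q ^ j * x))"
    using assms by (simp add: abs_mult summable_mult2)
  then have "abs_convergent_prod (\<lambda>j. 1 + q ^ j * x)"
    by (intro summable_imp_abs_convergent_prod) simp
  then show ?thesis
    unfolding q_prod_inf_def
    by (intro convergent_prod_has_prod abs_convergent_prod_imp_convergent_prod)
qed

lemma q_prod_inf_shift:
  assumes "0 < q"
  shows "q_prod_inf q (q powr \<alpha> * x) = (\<Prod>j. 1 + q powr (real j + \<alpha>) * x)"
  using assms by (simp add: q_prod_inf_def powr_add powr_realpow mult.assoc)

end

theory Submission
  imports Defs
begin

text \<open>
  Write \<open>P y = (1 + y)\<^sub>q\<^sup>\<infinity>\<close> and \<open>t = q\<^sup>\<alpha>\<close>. Each factor \<open>1 + q\<^sup>j y\<close> is affine and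
  positive for \<open>y > -1\<close>, hence \<open>ln P\<close> is concave there and \<open>1 / P\<close> is convex
  (\<open>convex_on_inverse_q_prod_inf\<close>). So \<open>t \<mapsto> P x / P (t x)\<close>, which is the \<open>q\<close>-power
  as a function of \<open>t = q\<^sup>\<alpha>\<close>, is convex on \<open>(0, 1]\<close>.

  On the other side, \<open>1 + [\<alpha>]\<^sub>q x = 1 + x (1 - t) / (1 - q)\<close> is affine in \<open>t\<close>, and the two functions
  agree at \<open>t = 1\<close> (the exponent \<open>0\<close>) and, because \<open>P x = (1 + x) P (q x)\<close>, at \<open>t = q\<close>
  (the exponent \<open>1\<close>). Thus the affine function is the chord of a convex function over
  \<open>[q, 1]\<close>: it lies above the function on the chord, which is the range \<open>0 < \<alpha> < 1\<close>, and below it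
  on the continuation to \<open>t \<le> q\<close>, which is the range \<open>\<alpha> \<ge> 1\<close>.
\<close>

lemma q_prod_factor_pos:
  fixes q y :: real
  assumes "0 < q" "q < 1" "y > -1"
  shows "1 + q ^ j * y > 0"
proof (cases "y \<ge> 0")
  case True
  then show ?thesis
    using assms by (simp add: add_pos_nonneg)
next
  case False
  have "q ^ j \<le> 1"
    using assms by (simp add: power_le_one)
  then have "q ^ j * y \<ge> 1 * y"
    using False by (intro mult_right_mono_neg) auto
  then show ?thesis
    using assms by simp
qed

lemma q_prod_inf_pos:
  assumes "0 < q" "q < 1" "y > -1"
  shows "q_prod_inf q y > 0"
  using has_prod_pos[OF q_prod_inf_has_prod[OF assms(1,2)]] q_prod_factor_pos[OF assms] by blast

lemma q_prod_inf_split_head: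
  assumes "0 < q" "q < 1"
  shows "q_prod_inf q x = (1 + x) * q_prod_inf q (q * x)"
proof -
  have "(\<lambda>j. 1 + q ^ Suc j * x) has_prod q_prod_inf q (q * x)"
    using q_prod_inf_has_prod[OF assms, of "q * x"] by (simp add: mult_ac)
  then have "(\<lambda>j. 1 + q ^ j * x) has_prod (q_prod_inf q (q * x) * (1 + q ^ 0 * x))"
    by (rule has_prod_Suc_imp)
  then show ?thesis
    using has_prod_unique2[OF q_prod_inf_has_prod[OF assms]] by (simp add: mult.commute)
qed

text \<open>
  The logarithm turns the product into a series of functions \<open>y \<mapsto> ln (1 + q\<^sup>j y)\<close>, each of
  them concave as the logarithm of an affine function, and concavity survives the summation.
\<close>

lemma concave_on_ln_q_prod_inf:
  assumes "0 < q" "q < 1"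
  shows "concave_on {-1<..} (\<lambda>y. ln (q_prod_inf q y))"
  unfolding concave_on_iff
proof (intro conjI ballI allI impI)
  show "convex ({-1<..} :: real set)"
    by (rule convex_real_interval)
next
  fix x y u v :: real
  assume xy: "x \<in> {-1<..}" "y \<in> {-1<..}" and uv: "0 \<le> u" "0 \<le> v" "u + v = 1"
  have ln_sums: "(\<lambda>j. ln (1 + q ^ j * z)) sums ln (q_prod_inf q z)" if "z > -1" for z
    using has_prod_imp_sums_ln_real'[OF q_prod_inf_has_prod[OF assms]]
      q_prod_factor_pos[OF assms that] by blast
  have "u *\<^sub>R x + v *\<^sub>R y \<in> {-1<..}"
    using convexD[OF convex_real_interval(3)] xy uv by blast
  then have z: "u * x + v * y > -1"
    by simp
  have "u * ln (1 + q ^ j * x) + v * ln (1 + q ^ j * y) \<le> ln (1 + q ^ j * (u * x + v * y))" for j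
  proof -
    have "u * ln (1 + q ^ j * x) + v * ln (1 + q ^ j * y)
        \<le> ln (u *\<^sub>R (1 + q ^ j * x) + v *\<^sub>R (1 + q ^ j * y))"
      using ln_concave q_prod_factor_pos[OF assms] xy uv unfolding concave_on_iff by auto
    also have "u *\<^sub>R (1 + q ^ j * x) + v *\<^sub>R (1 + q ^ j * y) = (u + v) + q ^ j * (u * x + v * y)"
      by (simp add: algebra_simps)
    finally show ?thesis
      using uv by simp
  qed
  moreover have "(\<lambda>j. u * ln (1 + q ^ j * x) + v * ln (1 + q ^ j * y)) sums
      (u * ln (q_prod_inf q x) + v * ln (q_prod_inf q y))"
    using xy by (intro sums_add sums_mult ln_sums) auto
  ultimately have "u * ln (q_prod_inf q x) + v * ln (q_prod_inf q y)
      \<le> ln (q_prod_inf q (u * x + v * y))"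
    using ln_sums[OF z] by (rule sums_le)
  then show "u * ln (q_prod_inf q x) + v * ln (q_prod_inf q y)
      \<le> ln (q_prod_inf q (u *\<^sub>R x + v *\<^sub>R y))"
    by simp
qed

lemma convex_on_inverse_of_log_concave:
  fixes f :: "'a::real_vector \<Rightarrow> real"
  assumes "concave_on S (\<lambda>x. ln (f x))" "\<And>x. x \<in> S \<Longrightarrow> f x > 0"
  shows "convex_on S (\<lambda>x. inverse (f x))"
proof
  show S: "convex S"
    using assms(1) by (rule concave_on_imp_convex)
  fix t :: real and x y
  assume t: "0 < t" "t < 1" and xy: "x \<in> S" "y \<in> S"
  have inv: "inverse (f z) = exp (- ln (f z))" if "z \<in> S" for z
    using assms(2)[OF that] by (simp add: exp_minus)
  have "(1 - t) *\<^sub>R x + t *\<^sub>R y \<in> S"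
    using S t xy by (simp add: convex_alt)
  then have "inverse (f ((1 - t) *\<^sub>R x + t *\<^sub>R y)) = exp (- ln (f ((1 - t) *\<^sub>R x + t *\<^sub>R y)))"
    by (rule inv)
  also have "\<dots> \<le> exp ((1 - t) *\<^sub>R (- ln (f x)) + t *\<^sub>R (- ln (f y)))"
    using concave_onD[OF assms(1), of t x y] t xy by simp
  also have "\<dots> \<le> (1 - t) * exp (- ln (f x)) + t * exp (- ln (f y))"
    using t by (intro convex_onD[OF exp_convex]) auto
  finally show "inverse (f ((1 - t) *\<^sub>R x + t *\<^sub>R y)) \<le> (1 - t) * inverse (f x) + t * inverse (f y)"
    using inv xy by simp
qed

lemma convex_on_inverse_q_prod_inf:
  assumes "0 < q" "q < 1"
  shows "convex_on {-1<..} (\<lambda>y. inverse (q_prod_inf q y))"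
  using concave_on_ln_q_prod_inf[OF assms] q_prod_inf_pos[OF assms]
  by (intro convex_on_inverse_of_log_concave) auto

text \<open>
  Scaling the argument of \<open>1 / P\<close> by the fixed \<open>x\<close> and multiplying by \<open>P x > 0\<close> preserves convexity.
  The interval ends at \<open>1\<close>, the value of \<open>t = q\<^sup>\<alpha>\<close> at \<open>\<alpha> = 0\<close>, since for negative \<open>x\<close> a larger \<open>t\<close>
  may push \<open>t x\<close> below \<open>-1\<close>.
\<close>

lemma convex_on_q_prod_inf_ratio:
  assumes "0 < q" "q < 1" "x > -1"
  shows "convex_on {0..1} (\<lambda>t. q_prod_inf q x / q_prod_inf q (t * x))"
proof
  fix s a b :: real
  assume s: "0 < s" "s < 1" and ab: "a \<in> {0..1}" "b \<in> {0..1}"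
  have in_dom: "c * x \<in> {-1<..}" if "c \<in> {0..1}" for c
    using q_prod_factor_pos[of c x 1] that assms(3) by (cases "c = 0 \<or> c = 1") auto
  have "inverse (q_prod_inf q ((1 - s) *\<^sub>R (a * x) + s *\<^sub>R (b * x)))
      \<le> (1 - s) * inverse (q_prod_inf q (a * x)) + s * inverse (q_prod_inf q (b * x))"
    using s ab by (intro convex_onD[OF convex_on_inverse_q_prod_inf[OF assms(1,2)]] in_dom) auto
  then have "q_prod_inf q x * inverse (q_prod_inf q ((1 - s) *\<^sub>R (a * x) + s *\<^sub>R (b * x)))
      \<le> q_prod_inf q x *
        ((1 - s) * inverse (q_prod_inf q (a * x)) + s * inverse (q_prod_inf q (b * x)))"
    using q_prod_inf_pos[OF assms] by (intro mult_left_mono) auto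
  then show "q_prod_inf q x / q_prod_inf q (((1 - s) *\<^sub>R a + s *\<^sub>R b) * x)
      \<le> (1 - s) * (q_prod_inf q x / q_prod_inf q (a * x)) +
        s * (q_prod_inf q x / q_prod_inf q (b * x))"
    by (simp add: divide_inverse algebra_simps)
qed (rule convex_real_interval)

lemma q_prod_inf_ratio_endpoints:
  assumes "0 < q" "q < 1" "x > -1"
  shows "q_prod_inf q x / q_prod_inf q (1 * x) = 1"
    and "q_prod_inf q x / q_prod_inf q (q * x) = 1 + x"
proof -
  show "q_prod_inf q x / q_prod_inf q (1 * x) = 1"
    using q_prod_inf_pos[OF assms] by simp
  have "q_prod_inf q (q * x) \<noteq> 0"
    using q_prod_inf_pos[OF assms] q_prod_inf_split_head[OF assms(1,2), of x] by auto
  then show "q_prod_inf q x / q_prod_inf q (q * x) = 1 + x"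
    by (simp add: q_prod_inf_split_head[OF assms(1,2), of x])
qed

theorem q_bernoulli_ge:
  assumes q: "0 < q" "q < 1" and x: "x > -1" and \<alpha>: "\<alpha> \<ge> 1"
  shows "q_binom_power q x \<alpha> \<ge> 1 + q_number q \<alpha> * x"
proof -
  define t where "t = q powr \<alpha>"
  define F where "F s = q_prod_inf q x / q_prod_inf q (s * x)" for s
  have "q powr \<alpha> \<le> q powr 1"
    using q \<alpha> by (intro powr_mono') auto
  then have t: "0 < t" "t \<le> q" "t < 1"
    using q by (auto simp: t_def)
  \<comment> \<open>the weight that writes \<open>q\<close> as a convex combination of \<open>t\<close> and \<open>1\<close>\<close>
  define s where "s = (q - t) / (1 - t)"
  have "s * (1 - t) = q - t"
    using t by (simp add: s_def)
  then have "(1 - s) * t + s * 1 = q"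
    by (simp add: algebra_simps)
  moreover have "0 \<le> s" "s \<le> 1" "1 - s = (1 - q) / (1 - t)"
    using t q by (auto simp: s_def field_simps)
  ultimately have s: "0 \<le> s" "s \<le> 1" "1 - s = (1 - q) / (1 - t)" "(1 - s) * t + s * 1 = q"
    by auto
  have "F ((1 - s) *\<^sub>R t + s *\<^sub>R 1) \<le> (1 - s) * F t + s * F 1"
    unfolding F_def using s t
    by (intro convex_onD[OF convex_on_q_prod_inf_ratio[OF q x]]) auto
  then have "1 + x \<le> (1 - s) * F t + s"
    using s(4) q_prod_inf_ratio_endpoints[OF q x] by (simp add: F_def)
  then have "x \<le> (1 - s) * (F t - 1)"
    by (simp add: algebra_simps)
  then have "(1 - t) / (1 - q) * x \<le> F t - 1"
    unfolding s(3) using t q by (simp add: field_simps)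
  moreover have "(1 - t) / (1 - q) = q_number q \<alpha>"
    using q by (simp add: q_number_def t_def divide_simps algebra_simps)
  ultimately have "1 + q_number q \<alpha> * x \<le> F t"
    by simp
  then show ?thesis
    by (simp add: q_binom_power_def F_def t_def)
qed

theorem q_bernoulli_le:
  assumes q: "0 < q" "q < 1" and x: "x > -1" and \<alpha>: "0 < \<alpha>" "\<alpha> < 1"
  shows "q_binom_power q x \<alpha> \<le> 1 + q_number q \<alpha> * x"
proof -
  define t where "t = q powr \<alpha>"
  define F where "F s = q_prod_inf q x / q_prod_inf q (s * x)" for s
  have "q powr 1 \<le> q powr \<alpha>" "q powr \<alpha> \<le> q powr 0"
    using q \<alpha> by (intro powr_mono'; simp)+
  then have t: "q \<le> t" "t \<le> 1"
    using q by (auto simp: t_def)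
  \<comment> \<open>the weight that writes \<open>t\<close> as a convex combination of \<open>q\<close> and \<open>1\<close>\<close>
  define s where "s = (t - q) / (1 - q)"
  have "s * (1 - q) = t - q"
    using q by (simp add: s_def)
  then have "(1 - s) * q + s * 1 = t"
    by (simp add: algebra_simps)
  moreover have "0 \<le> s" "s \<le> 1" "1 - s = (1 - t) / (1 - q)"
    using t q by (auto simp: s_def field_simps)
  ultimately have s: "0 \<le> s" "s \<le> 1" "1 - s = (1 - t) / (1 - q)" "(1 - s) * q + s * 1 = t"
    by auto
  have "F ((1 - s) *\<^sub>R q + s *\<^sub>R 1) \<le> (1 - s) * F q + s * F 1"
    unfolding F_def using s q
    by (intro convex_onD[OF convex_on_q_prod_inf_ratio[OF q x]]) auto
  then have "F t \<le> (1 - s) * (1 + x) + s"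
    using s(4) q_prod_inf_ratio_endpoints[OF q x] by (simp add: F_def)
  then have "F t \<le> 1 + (1 - s) * x"
    by (simp add: algebra_simps)
  moreover have "1 - s = q_number q \<alpha>"
    unfolding s(3) using q by (simp add: q_number_def t_def divide_simps algebra_simps)
  ultimately show ?thesis
    by (simp add: q_binom_power_def F_def t_def)
qed

theorem theorem3:
  shows "\<exists>q0::real. 0 < q0 \<and> q0 < 1 \<and>
    (\<forall>q x :: real. q0 < q \<and> q < 1 \<and> x > -1 \<longrightarrow>
      (\<forall>\<alpha>::real. \<alpha> \<ge> 1 \<longrightarrow> q_binom_power q x \<alpha> \<ge> 1 + q_number q \<alpha> * x) \<and>
      (\<forall>\<alpha>::real. 0 < \<alpha> \<and> \<alpha> < 1 \<longrightarrow> q_binom_power q x \<alpha> \<le> 1 + q_number q \<alpha> * x))"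
  \<comment> \<open>Both inequalities hold on all of \<open>0 < q < 1\<close>, so \<open>1 / 2\<close> is an arbitrary choice.\<close>
  by (intro exI[of _ "1 / 2"]) (auto intro: q_bernoulli_ge q_bernoulli_le)

end
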